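(* Let $2\le k<v$ be integers, and let $r=\frac{v-1}{k-1}$ and $b=\frac{v(v-1)}{k(k-1)}$. If there exists a $\mathrm{BIBD}(v,k,1)$ that contains a parallel class and if there exists a real Hadamard matrix of size $r+1$, then there exists a strongly regular graph $\mathrm{SRG}(v_{\mathrm{srg}},k_{\mathrm{srg}},\lambda,\mu)$ with parameters $$v_{\mathrm{srg}}=v(r+1),\quad k_{\mathrm{srg}}=\tfrac{(v+k-1)(r+1)}2,\quad \lambda=\tfrac{(v+3k-4)(r+1)}4,\quad \mu=\tfrac{(v+k)(r+1)}4.$$ Specifically, there exists an axial ETF of $n=v(r+1)$ vectors for $\mathbb{R}^b$, with synthesis operator $\Phi$, such that $A=\frac1{2\beta}\Phi^*\Phi-\frac{\beta+1}{2\beta}I+\frac12J$, where $\beta=\left[\frac{n-b}{b(n-1)}\right]^{1/2}$, is the adjacency matrix of such a strongly regular graph.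
   Context: A $\mathrm{BIBD}(v,k,1)$ with $2\le k<v$ is a $v$-element set $\mathcal{V}$ together with a set $\mathcal{B}$ of $k$-element subsets of $\mathcal{V}$ (called blocks) such that every element of $\mathcal{V}$ lies in the same number $r$ of blocks, and every pair of distinct elements of $\mathcal{V}$ is contained in exactly one block. Necessarily $r=\frac{v-1}{k-1}$, and the number of blocks is $b=\frac{v(v-1)}{k(k-1)}$. A parallel class is a subcollection of the blocks that forms a partition of $\mathcal{V}$. A real Hadamard matrix of size $N$ is an $N\times N$ matrix with entries $\pm1$ and orthogonal rows. For vectors $\{\varphi_i\}_{i=1}^n$ in $\mathbb{R}^m$, the synthesis operator $\Phi$ is the $m\times n$ matrix whose $i$th column is $\varphi_i$. The sequence is an equiangular tight frame (ETF) for $\mathbb{R}^m$ if every $\varphi_i$ has unit norm, $|\langle\varphi_i,\varphi_j\rangle|$ is constant over all $i\neq j$, and $\Phi\Phi^*=\alpha I$ for some $\alpha>0$ (necessarily $\alpha=\frac nm$). Let $\mathbf{1}$ be the all-ones vector, $J=\mathbf{1}\mathbf{1}^*$, and $I$ the identity. An ETF is axial if $\mathbf{1}$ lies in the column space of $\Phi^*$ (equivalently $\Phi^*\Phi\mathbf{1}=\alpha\mathbf{1}$). A simple graph on $v$ vertices with adjacency matrix $A$ is an $\mathrm{SRG}(v,k,\lambda,\mu)$ (strongly regular graph) if it is $k$-regular and $A^2=(\lambda-\mu)A+(k-\mu)I+\mu J$; i.e. any two neighbors have exactly $\lambda$ common neighbors and any two distinct nonneighbors have exactly $\mu$ common neighbors.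 *)

theory Defs
  imports
    Complex_Main
    "HOL-Library.Disjoint_Sets"
    "Jordan_Normal_Form.VS_Connect"
    "Graph_Theory.Pair_Digraph"
begin

definition bibd_one :: "nat \<Rightarrow> nat \<Rightarrow> 'a set \<Rightarrow> 'a set set \<Rightarrow> bool" where
  "bibd_one v k V B \<longleftrightarrow>
     2 \<le> k \<and> k < v \<and> finite V \<and> card V = v \<and>
     (\<forall>b\<in>B. b \<subseteq> V \<and> card b = k) \<and>
     (\<exists>r. \<forall>x\<in>V. card {b \<in> B. x \<in> b} = r) \<and>
     (\<forall>x\<in>V. \<forall>y\<in>V. x \<noteq> y \<longrightarrow> (\<exists>!b. b \<in> B \<and> x \<in> b \<and> y \<in> b))"

definition parallel_class :: "'a set \<Rightarrow> 'a set set \<Rightarrow> 'a set set \<Rightarrow> bool" where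
  "parallel_class V B P \<longleftrightarrow> P \<subseteq> B \<and> partition_on V P"

definition real_hadamard :: "nat \<Rightarrow> real mat \<Rightarrow> bool" where
  "real_hadamard N H \<longleftrightarrow>
     H \<in> carrier_mat N N \<and>
     (\<forall>i<N. \<forall>j<N. H $$ (i, j) \<in> {1, -1}) \<and>
     (\<forall>i<N. \<forall>j<N. i \<noteq> j \<longrightarrow> row H i \<bullet> row H j = 0)"

definition ones_vec :: "nat \<Rightarrow> real vec" where
  "ones_vec n = vec n (\<lambda>_. 1)"

definition ones_mat :: "nat \<Rightarrow> real mat" where
  "ones_mat n = mat n n (\<lambda>_. 1)"

text \<open>A sequence of \<open>n\<close> vectors in \<open>m\<close>-dimensional real space is given by its
  synthesis operator \<open>\<Phi>\<close>, the \<open>m \<times> n\<close> matrix having these vectors as columns.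
  Since the scalars are real, the adjoint of \<open>\<Phi>\<close> is its transpose.\<close>

definition equiangular_tight_frame :: "nat \<Rightarrow> nat \<Rightarrow> real mat \<Rightarrow> bool" where
  "equiangular_tight_frame m n \<Phi> \<longleftrightarrow>
     \<Phi> \<in> carrier_mat m n \<and>
     (\<forall>i<n. sqrt (col \<Phi> i \<bullet> col \<Phi> i) = 1) \<and>
     (\<exists>c. \<forall>i<n. \<forall>j<n. i \<noteq> j \<longrightarrow> \<bar>col \<Phi> i \<bullet> col \<Phi> j\<bar> = c) \<and>
     (\<exists>\<alpha>>0. \<Phi> * transpose_mat \<Phi> = \<alpha> \<cdot>\<^sub>m 1\<^sub>m m)"

definition axial_etf :: "nat \<Rightarrow> nat \<Rightarrow> real mat \<Rightarrow> bool" where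
  "axial_etf m n \<Phi> \<longleftrightarrow>
     equiangular_tight_frame m n \<Phi> \<and>
     ones_vec n \<in> vec_space.col_space n (transpose_mat \<Phi>)"

definition adjacency_mat :: "nat \<Rightarrow> nat pair_pre_digraph \<Rightarrow> real mat" where
  "adjacency_mat n G = mat n n (\<lambda>(i, j). if (i, j) \<in> parcs G then 1 else 0)"

text \<open>The vertices are labelled by \<open>0, \<dots>, n - 1\<close>, so that the adjacency matrix is
  determined by the graph. The locale \<open>pair_graph\<close> describes finite simple graphs,
  an undirected edge being a pair of opposite arcs.\<close>

definition strongly_regular_graph ::
  "nat \<Rightarrow> nat \<Rightarrow> nat \<Rightarrow> nat \<Rightarrow> nat pair_pre_digraph \<Rightarrow> bool" where
  "strongly_regular_graph n k l u G \<longleftrightarrow>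
     pair_graph G \<and> pverts G = {0..<n} \<and>
     (\<forall>x\<in>pverts G. out_degree (with_proj G) x = k) \<and>
     adjacency_mat n G * adjacency_mat n G =
       (real l - real u) \<cdot>\<^sub>m adjacency_mat n G +
       (real k - real u) \<cdot>\<^sub>m 1\<^sub>m n +
       real u \<cdot>\<^sub>m ones_mat n"

end

theory Submission
  imports Defs "Jordan_Normal_Form.Determinant"
begin

text \<open>The frame is a Steiner frame: the vector of a point \<open>x\<close> and a column \<open>j\<close> of the Hadamard matrix is
  supported on the \<open>r\<close> blocks through \<open>x\<close> and carries there, scaled by \<open>1 / sqrt r\<close>, the entries of
  column \<open>j\<close> in all rows but one. Two vectors at the same point have inner product \<open>\<plusminus>1 / r\<close> because
  of the dropped row, two vectors at different points because the points share exactly one block.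
  With the matrix normalised to have an all-ones row, and this row assigned to the blocks of the
  parallel class, the rows of the synthesis operator indexed by that class add up to a constant, so
  the frame is axial. The graph is then strongly regular because its adjacency matrix is a
  combination of \<open>I\<close>, \<open>J\<close> and the Gram matrix \<open>M\<close>, where \<open>M M\<close> and \<open>M 1\<close> are multiples of \<open>M\<close> and \<open>1\<close>.
  The parameters are integral because three orthogonal sign vectors force \<open>4\<close> to divide \<open>r + 1\<close>.\<close>

section \<open>Hadamard matrices\<close>

lemma sign_square: "x \<in> {1, -1} \<Longrightarrow> x * x = (1::real)"
  by auto

lemma sign_mult: "x \<in> {1, -1} \<Longrightarrow> y \<in> {1, -1} \<Longrightarrow> x * y \<in> {1, - 1 :: real}"
  by auto

text \<open>The product detects agreement of all three signs: if \<open>y\<close> or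
  \<open>z\<close> differs from \<open>x\<close>, the corresponding factor vanishes, and otherwise
  both factors are \<open>2\<close> or both are \<open>-2\<close>.\<close>

lemma sign_triple:
  "\<lbrakk>x \<in> {1, -1}; y \<in> {1, -1}; z \<in> {1, -1}\<rbrakk> \<Longrightarrow>
    (x + y) * (x + z) = (if x = y \<and> x = z then 4 else (0::real))"
  by (elim insertE emptyE) simp_all

lemma hadamard_entry: "real_hadamard N H \<Longrightarrow> i < N \<Longrightarrow> j < N \<Longrightarrow> H $$ (i, j) \<in> {1, -1}"
  unfolding real_hadamard_def by blast

lemma hadamard_row_orthogonality:
  assumes "real_hadamard N H" "i < N" "j < N"
  shows "(\<Sum>c<N. H $$ (i, c) * H $$ (j, c)) = (if i = j then real N else 0)"
proof (cases "i = j")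
  case True
  have "H $$ (j, c) * H $$ (j, c) = 1" if "c < N" for c
    by (rule sign_square, rule hadamard_entry) (use assms that in auto)
  then show ?thesis using True by simp
next
  case False
  then have "row H i \<bullet> row H j = 0" and "H \<in> carrier_mat N N"
    using assms by (auto simp: real_hadamard_def)
  then show ?thesis
    using False assms by (simp add: scalar_prod_def lessThan_atLeast0)
qed

text \<open>Row orthogonality makes the transpose, divided by \<open>N\<close>, a right inverse of
  \<open>H\<close>. For square matrices a right inverse is also a left inverse, and that is column
  orthogonality.\<close>

lemma hadamard_column_orthogonality:
  assumes "real_hadamard N H" "i < N" "j < N"
  shows "(\<Sum>c<N. H $$ (c, i) * H $$ (c, j)) = (if i = j then real N else 0)"
proof -
  have H: "H \<in> carrier_mat N N" using assms by (simp add: real_hadamard_def)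
  define K where "K = (1 / real N) \<cdot>\<^sub>m transpose_mat H"
  have K: "K \<in> carrier_mat N N" using H by (simp add: K_def)
  have "H * K = 1\<^sub>m N"
  proof (rule eq_matI)
    fix a c assume "a < dim_row (1\<^sub>m N :: real mat)" "c < dim_col (1\<^sub>m N :: real mat)"
    then have ac: "a < N" "c < N" by simp_all
    have "(H * K) $$ (a, c) = (\<Sum>l<N. H $$ (a, l) * H $$ (c, l)) / real N"
      using H ac by (simp add: K_def scalar_prod_def lessThan_atLeast0 sum_divide_distrib)
    then show "(H * K) $$ (a, c) = 1\<^sub>m N $$ (a, c)"
      using hadamard_row_orthogonality[OF assms(1) ac] ac by simp
  qed (use H K in auto)
  then have "K * H = 1\<^sub>m N" by (rule mat_mult_left_right_inverse[OF H K])
  then have "(K * H) $$ (i, j) = (if i = j then 1 else 0)" using assms by simp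
  moreover have "(K * H) $$ (i, j) = (\<Sum>c<N. H $$ (c, i) * H $$ (c, j)) / real N"
    using H assms by (simp add: K_def scalar_prod_def lessThan_atLeast0 sum_divide_distrib)
  ultimately show ?thesis using assms by (auto simp: field_simps split: if_splits)
qed

text \<open>Sum \<open>(x + y) * (x + z)\<close> over the columns, where \<open>x\<close>,
  \<open>y\<close>, \<open>z\<close> are the entries of the first three rows. Expanding, only the
  square of the first row survives orthogonality and gives \<open>N\<close>; by
  \<open>sign_triple\<close> each summand is \<open>0\<close> or \<open>4\<close>.\<close>

lemma hadamard_order_dvd:
  assumes H: "real_hadamard N H" and N: "3 \<le> N"
  shows "4 dvd N"
proof -
  let ?S = "{c. c < N \<and> H $$ (0, c) = H $$ (1, c) \<and> H $$ (0, c) = H $$ (2, c)}"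
  have "(\<Sum>c<N. (H $$ (0, c) + H $$ (1, c)) * (H $$ (0, c) + H $$ (2, c))) =
        (\<Sum>c<N. H $$ (0, c) * H $$ (0, c)) + (\<Sum>c<N. H $$ (0, c) * H $$ (2, c))
        + (\<Sum>c<N. H $$ (1, c) * H $$ (0, c)) + (\<Sum>c<N. H $$ (1, c) * H $$ (2, c))"
    unfolding sum.distrib[symmetric] by (rule sum.cong[OF refl]) (simp add: algebra_simps)
  also have "\<dots> = real N"
    using N by (simp add: hadamard_row_orthogonality[OF H])
  finally have "real N = (\<Sum>c<N. (H $$ (0, c) + H $$ (1, c)) * (H $$ (0, c) + H $$ (2, c)))" ..
  also have "\<dots> = (\<Sum>c<N. if H $$ (0, c) = H $$ (1, c) \<and> H $$ (0, c) = H $$ (2, c) then 4 else 0)"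
  proof (rule sum.cong)
    fix c assume "c \<in> {..<N}"
    then have c: "c < N" by simp
    have "0 < N" "1 < N" "2 < N" using N by simp_all
    note entries = this[THEN hadamard_entry[OF H], OF c]
    show "(H $$ (0, c) + H $$ (1, c)) * (H $$ (0, c) + H $$ (2, c)) =
      (if H $$ (0, c) = H $$ (1, c) \<and> H $$ (0, c) = H $$ (2, c) then 4 else 0)"
      by (rule sign_triple[OF entries])
  qed simp
  also have "\<dots> = (\<Sum>c\<in>?S. 4)"
    by (rule sum.mono_neutral_cong_right) auto
  also have "\<dots> = real (4 * card ?S)" by simp
  finally have "N = 4 * card ?S" by linarith
  then show ?thesis by (rule dvdI)
qed

text \<open>Each column is multiplied by its own top entry. In a product of two rows this sign is
  squared away; a product of two columns changes at most in sign, which is invisible off the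
  diagonal, and on the diagonal the sign is squared.\<close>

lemma normalized_hadamard:
  assumes H: "real_hadamard N H" and N: "0 < N"
  obtains h :: "nat \<Rightarrow> nat \<Rightarrow> real" where
    "\<And>j. j < N \<Longrightarrow> h 0 j = 1"
    "\<And>i j. i < N \<Longrightarrow> j < N \<Longrightarrow> h i j \<in> {1, -1}"
    "\<And>i j. i < N \<Longrightarrow> j < N \<Longrightarrow> (\<Sum>c<N. h i c * h j c) = (if i = j then real N else 0)"
    "\<And>i j. i < N \<Longrightarrow> j < N \<Longrightarrow> (\<Sum>c<N. h c i * h c j) = (if i = j then real N else 0)"
proof -
  define h where "h = (\<lambda>i j. H $$ (i, j) * H $$ (0, j))"
  note pm = hadamard_entry[OF H] and sq = sign_square[OF hadamard_entry[OF H N]]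
  show thesis
  proof (rule that[of h])
    fix i j assume ij: "i < N" "j < N"
    show "h i j \<in> {1, -1}" unfolding h_def by (rule sign_mult[OF pm[OF ij] pm[OF N ij(2)]])
    have "h i c * h j c = H $$ (i, c) * H $$ (j, c)" if "c < N" for c
    proof -
      have "h i c * h j c = H $$ (i, c) * H $$ (j, c) * (H $$ (0, c) * H $$ (0, c))"
        by (simp add: h_def mult_ac)
      then show ?thesis using sq[OF that] by simp
    qed
    then show "(\<Sum>c<N. h i c * h j c) = (if i = j then real N else 0)"
      using hadamard_row_orthogonality[OF H ij] by simp
    have "(\<Sum>c<N. h c i * h c j) = (\<Sum>c<N. H $$ (c, i) * H $$ (c, j)) * (H $$ (0, i) * H $$ (0, j))"
      by (simp add: h_def sum_distrib_left sum_distrib_right mult_ac)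
    then show "(\<Sum>c<N. h c i * h c j) = (if i = j then real N else 0)"
      using hadamard_column_orthogonality[OF H ij] sq[OF ij(1)] by auto
  next
    fix j assume "j < N"
    then show "h 0 j = 1" using sq[of j] by (simp add: h_def)
  qed
qed

section \<open>Counting in designs\<close>

lemma bibd_finite_blocks: "bibd_one v k V B \<Longrightarrow> finite B"
  unfolding bibd_one_def by (meson Pow_iff finite_Pow_iff finite_subset subsetI)

text \<open>Double counting of the pairs of a block through \<open>x\<close> and a further point of
  it: each other point lies in one such block, each such block has \<open>k - 1\<close> further
  points.\<close>

lemma bibd_replication:
  assumes D: "bibd_one v k V B" and x: "x \<in> V"
  shows "card {b \<in> B. x \<in> b} * (k - 1) = v - 1"
proof -
  have V: "finite V" "card V = v" using D by (auto simp: bibd_one_def)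
  let ?S = "{b \<in> B. x \<in> b}"
  have one: "card {b \<in> ?S. y \<in> b} = 1" if "y \<in> V - {x}" for y
  proof -
    have "\<exists>!b. b \<in> B \<and> x \<in> b \<and> y \<in> b" using D x that unfolding bibd_one_def by blast
    then obtain b where "{b \<in> ?S. y \<in> b} = {b}" by blast
    then show ?thesis by simp
  qed
  have "(\<Sum>b\<in>?S. card {y \<in> V - {x}. y \<in> b}) = 1 * card (V - {x})"
    using bibd_finite_blocks[OF D] V one by (intro sum_multicount) auto
  moreover have "card {y \<in> V - {x}. y \<in> b} = k - 1" if "b \<in> ?S" for b
  proof -
    have "{y \<in> V - {x}. y \<in> b} = b - {x}" using D that by (auto simp: bibd_one_def)
    then show ?thesis using D that by (auto simp: bibd_one_def)
  qed
  ultimately show ?thesis using V x by simp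
qed

lemma bibd_block_count:
  assumes D: "bibd_one v k V B" and r: "\<And>x. x \<in> V \<Longrightarrow> card {b \<in> B. x \<in> b} = r"
  shows "card B * k = v * r"
proof -
  have V: "finite V" "card V = v" using D by (auto simp: bibd_one_def)
  have "(\<Sum>b\<in>B. card {x \<in> V. x \<in> b}) = r * card V"
    using bibd_finite_blocks[OF D] V r by (intro sum_multicount) auto
  moreover have "card {x \<in> V. x \<in> b} = k" if "b \<in> B" for b
  proof -
    have "{x \<in> V. x \<in> b} = b" using D that by (auto simp: bibd_one_def)
    then show ?thesis using D that by (auto simp: bibd_one_def)
  qed
  ultimately show ?thesis using V by simp
qed

section \<open>Steiner frames\<close>

text \<open>Used to number the blocks through a point so that its block in the parallel class
  receives \<open>0\<close>, the index of the all-ones row.\<close>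

lemma ex_bij_betw_lessThan_fixing:
  assumes "finite S" "card S = n" "s \<in> S"
  obtains f where "bij_betw f S {..<n}" "f s = 0"
proof -
  have "card (S - {s}) = card {1..<n}" using assms by simp
  then obtain g where g: "bij_betw g (S - {s}) {1..<n}"
    using finite_same_card_bij[of "S - {s}" "{1..<n}"] assms(1) by auto
  have "0 < n" using assms by (auto simp: card_gt_0_iff)
  then have "{1..<n} \<union> {0} = {..<n}" by auto
  moreover have "bij_betw (g(s := 0)) (S - {s} \<union> {s}) ({1..<n} \<union> {0})"
  proof (rule bij_betw_combine)
    have "bij_betw (g(s := 0)) (S - {s}) {1..<n} \<longleftrightarrow> bij_betw g (S - {s}) {1..<n}"
      by (rule bij_betw_cong) simp
    then show "bij_betw (g(s := 0)) (S - {s}) {1..<n}" using g by blast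
    show "bij_betw (g(s := 0)) {s} {0}" by (simp add: bij_betw_def)
  qed simp
  moreover have "S - {s} \<union> {s} = S" using assms(3) by blast
  ultimately show thesis using that[of "g(s := 0)"] by simp
qed

text \<open>Row \<open>R\<close> of the normalised Hadamard matrix \<open>h\<close> of order \<open>R + 1\<close> is dropped; for each point \<open>x\<close>,
  \<open>\<rho> x\<close> assigns the other rows to the blocks through \<open>x\<close>, with the all-ones row \<open>0\<close> going to the
  block of the parallel class.\<close>

locale steiner_frame =
  fixes V :: "'a set" and B P :: "'a set set" and v k R :: nat
    and h :: "nat \<Rightarrow> nat \<Rightarrow> real" and \<rho> :: "'a \<Rightarrow> 'a set \<Rightarrow> nat"
  assumes design: "bibd_one v k V B"
    and parallel: "parallel_class V B P"
    and R_pos: "0 < R"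
    and \<rho>_bij: "\<And>x. x \<in> V \<Longrightarrow> bij_betw (\<rho> x) {b \<in> B. x \<in> b} {..<R}"
    and \<rho>_parallel: "\<And>b x. b \<in> P \<Longrightarrow> x \<in> b \<Longrightarrow> \<rho> x b = 0"
    and h_0: "\<And>j. j < Suc R \<Longrightarrow> h 0 j = 1"
    and h_sign: "\<And>i j. i < Suc R \<Longrightarrow> j < Suc R \<Longrightarrow> h i j \<in> {1, -1}"
    and h_rows: "\<And>i j. i < Suc R \<Longrightarrow> j < Suc R \<Longrightarrow>
      (\<Sum>c<Suc R. h i c * h j c) = (if i = j then real (Suc R) else 0)"
    and h_cols: "\<And>i j. i < Suc R \<Longrightarrow> j < Suc R \<Longrightarrow>
      (\<Sum>c<Suc R. h c i * h c j) = (if i = j then real (Suc R) else 0)"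
begin

text \<open>The factor \<open>1 / sqrt R\<close> is left out here, so that all nonzero entries are
  signs; it enters with the matrix in \<open>synthesis_matrix\<close>.\<close>

definition \<phi> :: "'a set \<Rightarrow> 'a \<Rightarrow> nat \<Rightarrow> real" where
  "\<phi> b x j = (if x \<in> b then h (\<rho> x b) j else 0)"

lemma finite_B: "finite B" by (rule bibd_finite_blocks[OF design])

lemma finite_V: "finite V" and card_V: "card V = v"
  using design by (auto simp: bibd_one_def)

lemma block_subset: "b \<in> B \<Longrightarrow> b \<subseteq> V" and block_card: "b \<in> B \<Longrightarrow> card b = k"
  using design by (auto simp: bibd_one_def)

lemma unique_block: "x \<in> V \<Longrightarrow> y \<in> V \<Longrightarrow> x \<noteq> y \<Longrightarrow> \<exists>!b. b \<in> B \<and> x \<in> b \<and> y \<in> b"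
  using design unfolding bibd_one_def by blast

lemma \<rho>_less: "x \<in> b \<Longrightarrow> b \<in> B \<Longrightarrow> \<rho> x b < R"
  using \<rho>_bij[of x] block_subset by (auto simp: bij_betw_def)

text \<open>Through \<rho> the blocks at \<open>x\<close> run over all rows of \<open>h\<close>
  except row \<open>R\<close>, so the sum is the full column product minus the term of the dropped
  row.\<close>

lemma gram_same_point:
  assumes x: "x \<in> V" and ij: "i < Suc R" "j < Suc R"
  shows "(\<Sum>b\<in>B. \<phi> b x i * \<phi> b x j) = (if i = j then real R else - (h R i * h R j))"
proof -
  have "(\<Sum>b\<in>B. \<phi> b x i * \<phi> b x j) = (\<Sum>b | b \<in> B \<and> x \<in> b. h (\<rho> x b) i * h (\<rho> x b) j)"
    by (rule sum.mono_neutral_cong_right) (auto simp: finite_B \<phi>_def)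
  also have "\<dots> = (\<Sum>a<R. h a i * h a j)"
    by (rule sum.reindex_bij_betw[OF \<rho>_bij[OF x]])
  finally show ?thesis
    using h_cols[OF ij] h_sign[of R i] ij by auto
qed

text \<open>Only the one block containing both points contributes, with a product of two
  signs.\<close>

lemma gram_distinct_points:
  assumes "x \<in> V" "y \<in> V" "x \<noteq> y" "i < Suc R" "j < Suc R"
  shows "(\<Sum>b\<in>B. \<phi> b x i * \<phi> b y j) \<in> {1, -1}"
proof -
  obtain c where c: "c \<in> B" "x \<in> c" "y \<in> c" and uniq: "\<And>b. b \<in> B \<Longrightarrow> x \<in> b \<Longrightarrow> y \<in> b \<Longrightarrow> b = c"
    using unique_block[OF assms(1-3)] by blast
  have "(\<Sum>b\<in>B. \<phi> b x i * \<phi> b y j) = (\<Sum>b\<in>{c}. \<phi> b x i * \<phi> b y j)"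
  proof (rule sum.mono_neutral_right)
    show "\<forall>b\<in>B - {c}. \<phi> b x i * \<phi> b y j = 0" using uniq by (auto simp: \<phi>_def)
  qed (use c in \<open>auto simp: finite_B\<close>)
  also have "\<dots> = h (\<rho> x c) i * h (\<rho> y c) j" using c by (simp add: \<phi>_def)
  finally show ?thesis
    using sign_mult[OF h_sign h_sign, of "\<rho> x c" i "\<rho> y c" j] \<rho>_less[OF c(2,1)] \<rho>_less[OF c(3,1)] assms
    by simp
qed

text \<open>At a point on both blocks, the inner sum is a product of two rows of \<open>h\<close>.
  Since \<rho> is injective at each point, distinct blocks use distinct rows there and the sum
  vanishes; for equal blocks each of the \<open>k\<close> points contributes
  \<open>R + 1\<close>.\<close>

lemma frame_rows:
  assumes "b \<in> B" "c \<in> B"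
  shows "(\<Sum>x\<in>V. \<Sum>j<Suc R. \<phi> b x j * \<phi> c x j) = (if b = c then real k * real (Suc R) else 0)"
proof -
  have "(\<Sum>j<Suc R. \<phi> b x j * \<phi> c x j) = (if x \<in> b \<and> b = c then real (Suc R) else 0)"
    if x: "x \<in> V" for x
  proof (cases "x \<in> b \<and> x \<in> c")
    case True
    then have "\<rho> x b = \<rho> x c \<longleftrightarrow> b = c"
      using \<rho>_bij[OF x] assms by (auto simp: bij_betw_def inj_on_def)
    then show ?thesis
      using True h_rows[of "\<rho> x b" "\<rho> x c"] \<rho>_less[of x b] \<rho>_less[of x c] assms
      by (simp add: \<phi>_def del: sum.lessThan_Suc)
  next
    case False
    then show ?thesis by (auto simp: \<phi>_def intro!: sum.neutral)
  qed
  then have "(\<Sum>x\<in>V. \<Sum>j<Suc R. \<phi> b x j * \<phi> c x j) =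
      (\<Sum>x\<in>V. if x \<in> b \<and> b = c then real (Suc R) else 0)" by simp
  also have "\<dots> = (if b = c then \<Sum>x\<in>b. real (Suc R) else 0)"
  proof (cases "b = c")
    case True
    have "(\<Sum>x\<in>V. if x \<in> c then real (Suc R) else 0) = (\<Sum>x\<in>c. real (Suc R))"
      using block_subset[OF assms(2)] by (intro sum.mono_neutral_cong_right) (auto simp: finite_V)
    then show ?thesis using True by simp
  qed simp
  finally show ?thesis using assms by (simp add: block_card)
qed

text \<open>Exactly one block of the partition contains \<open>x\<close>, and at \<open>x\<close> it
  carries the all-ones row.\<close>

lemma axial_point:
  assumes x: "x \<in> V" and j: "j < Suc R"
  shows "(\<Sum>b\<in>P. \<phi> b x j) = 1"
proof -
  have P: "P \<subseteq> B" "\<Union>P = V" "disjoint P"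
    using parallel by (auto simp: parallel_class_def partition_on_def)
  then obtain c where c: "c \<in> P" "x \<in> c" using x by auto
  have "(\<Sum>b\<in>P. \<phi> b x j) = (\<Sum>b\<in>{c}. \<phi> b x j)"
  proof (rule sum.mono_neutral_right)
    show "finite P" using P(1) finite_B finite_subset by blast
    show "\<forall>b\<in>P - {c}. \<phi> b x j = 0" using P(3) c by (auto simp: \<phi>_def disjoint_def)
  qed (use c in auto)
  then show ?thesis using c j by (simp add: \<phi>_def \<rho>_parallel h_0)
qed

lemma synthesis_matrix:
  obtains \<Phi> w where "\<Phi> \<in> carrier_mat (card B) (v * Suc R)"
    "\<Phi> * transpose_mat \<Phi> = (real k * real (Suc R) / real R) \<cdot>\<^sub>m 1\<^sub>m (card B)"
    "\<And>i. i < v * Suc R \<Longrightarrow> col \<Phi> i \<bullet> col \<Phi> i = 1"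
    "\<And>i j. i < v * Suc R \<Longrightarrow> j < v * Suc R \<Longrightarrow> i \<noteq> j \<Longrightarrow>
      col \<Phi> i \<bullet> col \<Phi> j \<in> {1 / real R, - (1 / real R)}"
    "w \<in> carrier_vec (card B)" "transpose_mat \<Phi> *\<^sub>v w = ones_vec (v * Suc R)"
proof -
  let ?m = "card B" and ?N = "Suc R" and ?n = "v * Suc R"
  obtain e where e: "bij_betw e {..<?m} B"
    using ex_bij_betw_nat_finite[OF finite_B] by (auto simp: lessThan_atLeast0)
  obtain f where f: "bij_betw f {..<v} V"
    using ex_bij_betw_nat_finite[OF finite_V] by (auto simp: lessThan_atLeast0 card_V)
  \<comment> \<open>A column index encodes a pair: \<open>i div ?N\<close> numbers the point and
    \<open>i mod ?N\<close> the Hadamard column.\<close>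
  define F where "F = (\<lambda>a i. \<phi> (e a) (f (i div ?N)) (i mod ?N) / sqrt (real R))"
  define \<Phi> where "\<Phi> = mat ?m ?n (\<lambda>(a, i). F a i)"
  \<comment> \<open>The indicator of the parallel class; the value \<open>sqrt R\<close> cancels the
    normalisation in \<open>F\<close>.\<close>
  define w where "w = vec ?m (\<lambda>a. if e a \<in> P then sqrt (real R) else 0)"
  have e_B: "e a \<in> B" if "a < ?m" for a using e that by (auto simp: bij_betw_def)
  have f_V: "f (i div ?N) \<in> V" and mod_N: "i mod ?N < ?N" if "i < ?n" for i
    using f that by (auto simp: bij_betw_def less_mult_imp_div_less simp del: mult_Suc_right)
  have e_inj: "e a = e c \<longleftrightarrow> a = c" if "a < ?m" "c < ?m" for a c
    using e that by (auto simp: bij_betw_def inj_on_def)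
  have f_inj: "f (i div ?N) = f (j div ?N) \<longleftrightarrow> i div ?N = j div ?N" if "i < ?n" "j < ?n" for i j
    using f less_mult_imp_div_less[OF that(1)] less_mult_imp_div_less[OF that(2)]
    by (auto simp: bij_betw_def inj_on_def)
  have ij_eq: "i = j \<longleftrightarrow> i div ?N = j div ?N \<and> i mod ?N = j mod ?N" for i j
    by (metis div_mult_mod_eq)

  have gram: "col \<Phi> i \<bullet> col \<Phi> j =
      (\<Sum>b\<in>B. \<phi> b (f (i div ?N)) (i mod ?N) * \<phi> b (f (j div ?N)) (j mod ?N)) / real R"
    if ij: "i < ?n" "j < ?n" for i j
  proof -
    have "col \<Phi> i \<bullet> col \<Phi> j = (\<Sum>a<?m. F a i * F a j)"
      using ij by (simp add: \<Phi>_def scalar_prod_def lessThan_atLeast0 del: mult_Suc_right)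
    also have "\<dots> = (\<Sum>a<?m. \<phi> (e a) (f (i div ?N)) (i mod ?N) * \<phi> (e a) (f (j div ?N)) (j mod ?N)) / real R"
      by (simp add: F_def sum_divide_distrib)
    finally show ?thesis
      by (simp add: sum.reindex_bij_betw[OF e, of "\<lambda>b. \<phi> b (f (i div ?N)) (i mod ?N) * \<phi> b (f (j div ?N)) (j mod ?N)"])
  qed

  have rows: "(\<Sum>i<?n. F a i * F c i) = (if a = c then real k * real ?N / real R else 0)"
    if ac: "a < ?m" "c < ?m" for a c
  proof -
    let ?g = "\<lambda>x j. \<phi> (e a) x j * \<phi> (e c) x j"
    have "(\<Sum>i<?n. F a i * F c i) = (\<Sum>i<?n. ?g (f (i div ?N)) (i mod ?N)) / real R"
      by (simp add: F_def sum_divide_distrib del: mult_Suc_right)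
    \<comment> \<open>The columns are split into \<open>v\<close> runs of length \<open>?N\<close>,
      one for each point; shifting a run to start at \<open>0\<close> recovers the point and the
      Hadamard column.\<close>
    also have "(\<Sum>i<?n. ?g (f (i div ?N)) (i mod ?N)) =
        (\<Sum>p<v. \<Sum>i=p * ?N..<p * ?N + ?N. ?g (f (i div ?N)) (i mod ?N))"
      by (rule sum.nat_group[symmetric])
    also have "\<dots> = (\<Sum>p<v. \<Sum>j<?N. ?g (f p) j)"
    proof (rule sum.cong[OF refl])
      fix p
      have "(\<Sum>i=p * ?N..<p * ?N + ?N. ?g (f (i div ?N)) (i mod ?N)) =
          (\<Sum>j=0..<?N. ?g (f ((j + p * ?N) div ?N)) ((j + p * ?N) mod ?N))"
        using sum.shift_bounds_nat_ivl[of "\<lambda>i. ?g (f (i div ?N)) (i mod ?N)" 0 "p * ?N" ?N]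
        by (simp only: add_0 add.commute)
      also have "\<dots> = (\<Sum>j<?N. ?g (f p) j)"
        unfolding lessThan_atLeast0
        by (rule sum.cong) (simp_all del: mult_Suc_right sum.op_ivl_Suc)
      finally show "(\<Sum>i=p * ?N..<p * ?N + ?N. ?g (f (i div ?N)) (i mod ?N)) = (\<Sum>j<?N. ?g (f p) j)" .
    qed
    also have "\<dots> = (\<Sum>x\<in>V. \<Sum>j<?N. ?g x j)"
      by (rule sum.reindex_bij_betw[OF f])
    also have "\<dots> = (if e a = e c then real k * real ?N else 0)"
      by (rule frame_rows[OF e_B[OF ac(1)] e_B[OF ac(2)]])
    finally show ?thesis using e_inj[OF ac] by simp
  qed

  show thesis
  proof (rule that[of \<Phi> w])
    show "\<Phi> \<in> carrier_mat ?m ?n" by (simp add: \<Phi>_def)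
    show "w \<in> carrier_vec ?m" by (simp add: w_def)
    show "\<Phi> * transpose_mat \<Phi> = (real k * real ?N / real R) \<cdot>\<^sub>m 1\<^sub>m ?m"
    proof (rule eq_matI)
      fix a c assume "a < dim_row ((real k * real ?N / real R) \<cdot>\<^sub>m 1\<^sub>m ?m)"
        "c < dim_col ((real k * real ?N / real R) \<cdot>\<^sub>m 1\<^sub>m ?m)"
      then have ac: "a < ?m" "c < ?m" by simp_all
      have "(\<Phi> * transpose_mat \<Phi>) $$ (a, c) = (\<Sum>i<?n. F a i * F c i)"
        using ac by (simp add: \<Phi>_def scalar_prod_def lessThan_atLeast0 del: mult_Suc_right)
      then show "(\<Phi> * transpose_mat \<Phi>) $$ (a, c) = ((real k * real ?N / real R) \<cdot>\<^sub>m 1\<^sub>m ?m) $$ (a, c)"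
        using rows[OF ac] ac by simp
    qed (simp_all add: \<Phi>_def)
    show "col \<Phi> i \<bullet> col \<Phi> i = 1" if "i < ?n" for i
      using gram[OF that that] gram_same_point[OF f_V[OF that] mod_N[OF that] mod_N[OF that]] R_pos
      by simp
    show "col \<Phi> i \<bullet> col \<Phi> j \<in> {1 / real R, - (1 / real R)}"
      if ij: "i < ?n" "j < ?n" and neq: "i \<noteq> j" for i j
    proof (cases "f (i div ?N) = f (j div ?N)")
      case True
      then have "i mod ?N \<noteq> j mod ?N" using neq ij_eq f_inj[OF ij] by blast
      then have "col \<Phi> i \<bullet> col \<Phi> j = - (h R (i mod ?N) * h R (j mod ?N)) / real R"
        using gram[OF ij] True gram_same_point[OF f_V[OF ij(1)] mod_N[OF ij(1)] mod_N[OF ij(2)]]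
        by simp
      then show ?thesis
        using h_sign[OF lessI mod_N[OF ij(1)]] h_sign[OF lessI mod_N[OF ij(2)]] by auto
    next
      case False
      then show ?thesis
        using gram[OF ij] gram_distinct_points[OF f_V[OF ij(1)] f_V[OF ij(2)] False mod_N[OF ij(1)] mod_N[OF ij(2)]]
        by auto
    qed
    show "transpose_mat \<Phi> *\<^sub>v w = ones_vec ?n"
    proof (rule eq_vecI)
      fix i assume "i < dim_vec (ones_vec ?n)"
      then have i: "i < ?n" by (simp add: ones_vec_def)
      let ?g = "\<lambda>b. \<phi> b (f (i div ?N)) (i mod ?N)"
      have "(transpose_mat \<Phi> *\<^sub>v w) $ i = (\<Sum>a<?m. F a i * (if e a \<in> P then sqrt (real R) else 0))"
        using i by (simp add: \<Phi>_def w_def scalar_prod_def lessThan_atLeast0 del: mult_Suc_right)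
      also have "\<dots> = (\<Sum>a<?m. if e a \<in> P then ?g (e a) else 0)"
        using R_pos by (intro sum.cong) (auto simp: F_def)
      also have "\<dots> = (\<Sum>b\<in>B. if b \<in> P then ?g b else 0)"
        by (rule sum.reindex_bij_betw[OF e])
      also have "\<dots> = (\<Sum>b\<in>P. ?g b)"
        using parallel by (intro sum.mono_neutral_cong_right) (auto simp: finite_B parallel_class_def)
      also have "\<dots> = 1" by (rule axial_point[OF f_V[OF i] mod_N[OF i]])
      finally show "(transpose_mat \<Phi> *\<^sub>v w) $ i = ones_vec ?n $ i"
        using i by (simp add: ones_vec_def)
    qed (simp add: \<Phi>_def ones_vec_def)
  qed
qed

end

section \<open>The graph of an axial equiangular tight frame\<close>

text \<open>Two indices are adjacent when their inner product is \<open>+\<beta>\<close>. The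
  constants \<open>s\<close> and \<open>t\<close> make \<open>s M - t I + J / 2\<close> the
  adjacency matrix, \<open>M\<close> being the Gram matrix. As \<open>M M\<close> is \<alpha> times
  \<open>M\<close> and the all-ones vector is an eigenvector of \<open>M\<close> for \<alpha>, the
  square of this matrix is again a combination of itself, \<open>I\<close> and
  \<open>J\<close>.\<close>

lemma axial_frame_graph:
  fixes \<Phi> :: "real mat" and \<alpha> \<beta> :: real
  defines "s \<equiv> 1 / (2 * \<beta>)" and "t \<equiv> (\<beta> + 1) / (2 * \<beta>)"
  assumes \<Phi>: "\<Phi> \<in> carrier_mat m n" and \<beta>: "0 < \<beta>"
    and frame: "\<Phi> * transpose_mat \<Phi> = \<alpha> \<cdot>\<^sub>m 1\<^sub>m m"
    and unit: "\<And>i. i < n \<Longrightarrow> col \<Phi> i \<bullet> col \<Phi> i = 1"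
    and angle: "\<And>i j. i < n \<Longrightarrow> j < n \<Longrightarrow> i \<noteq> j \<Longrightarrow> col \<Phi> i \<bullet> col \<Phi> j \<in> {\<beta>, -\<beta>}"
    and w: "w \<in> carrier_vec m" and axial: "transpose_mat \<Phi> *\<^sub>v w = ones_vec n"
  obtains G where "pair_graph G" "pverts G = {0..<n}"
    "adjacency_mat n G = s \<cdot>\<^sub>m (transpose_mat \<Phi> * \<Phi>) - t \<cdot>\<^sub>m 1\<^sub>m n + (1 / 2) \<cdot>\<^sub>m ones_mat n"
    "\<And>x. x \<in> pverts G \<Longrightarrow> real (out_degree (with_proj G) x) = s * \<alpha> - t + real n / 2"
    "adjacency_mat n G * adjacency_mat n G =
      (s * \<alpha> - 2 * t) \<cdot>\<^sub>m adjacency_mat n G + (t * (s * \<alpha> - t)) \<cdot>\<^sub>m 1\<^sub>m n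
      + (real n / 4 + s * \<alpha> / 2) \<cdot>\<^sub>m ones_mat n"
proof -
  define g where "g = (\<lambda>i j. col \<Phi> i \<bullet> col \<Phi> j)"
  define G where "G = \<lparr> pverts = {0..<n}, parcs = {(i, j). i < n \<and> j < n \<and> i \<noteq> j \<and> g i j = \<beta>} \<rparr>"
  define A where "A = adjacency_mat n G"
  define M where "M = transpose_mat \<Phi> * \<Phi>"
  have M: "M \<in> carrier_mat n n" using \<Phi> by (simp add: M_def)
  have M_g: "M $$ (i, j) = g i j" if "i < n" "j < n" for i j
    using that \<Phi> by (simp add: M_def g_def)
  have g_sym: "g i j = g j i" if "i < n" "j < n" for i j
    using that \<Phi> unfolding g_def by (intro comm_scalar_prod[of _ m]) auto

  have "M * M = transpose_mat \<Phi> * (\<Phi> * transpose_mat \<Phi>) * \<Phi>"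
    using \<Phi> unfolding M_def by (simp add: assoc_mult_mat[of _ n m _ n _ n] assoc_mult_mat[of _ n m _ m _ n] assoc_mult_mat[of _ m n _ m _ n])
  also have "\<dots> = \<alpha> \<cdot>\<^sub>m M"
    using \<Phi> unfolding frame M_def
    by (simp add: mult_smult_distrib[of _ n m _ m] mult_smult_assoc_mat[of _ n m _ n])
  finally have M_square: "M * M = \<alpha> \<cdot>\<^sub>m M" .
  \<comment> \<open>The all-ones vector is the image of \<open>w\<close> under the transpose of
    \<Phi>, so applying \<open>M\<close> brings \<Phi> next to its transpose and tightness
    applies.\<close>
  have "M *\<^sub>v ones_vec n = transpose_mat \<Phi> *\<^sub>v ((\<Phi> * transpose_mat \<Phi>) *\<^sub>v w)"
    using \<Phi> w unfolding M_def axial[symmetric]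
    by (simp add: assoc_mult_mat_vec[of _ n m _ n] assoc_mult_mat_vec[of _ m n _ m])
  also have "\<dots> = \<alpha> \<cdot>\<^sub>v ones_vec n"
  proof -
    have "(\<alpha> \<cdot>\<^sub>m 1\<^sub>m m) *\<^sub>v w = \<alpha> \<cdot>\<^sub>v w"
      using w by (intro eq_vecI) (simp_all add: scalar_prod_left_unit smult_scalar_prod_distrib[of _ m])
    then show ?thesis
      using \<Phi> w unfolding frame axial[symmetric] by (simp add: mult_mat_vec[of _ n m])
  qed
  finally have M_ones: "M *\<^sub>v ones_vec n = \<alpha> \<cdot>\<^sub>v ones_vec n" .

  have g_square: "(\<Sum>l<n. g i l * g l j) = \<alpha> * g i j" if ij: "i < n" "j < n" for i j
  proof -
    have "(M * M) $$ (i, j) = (\<Sum>l<n. g i l * g l j)"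
      using M ij by (simp add: scalar_prod_def lessThan_atLeast0 M_g)
    then show ?thesis using M ij by (simp add: M_square M_g)
  qed
  have g_sum: "(\<Sum>l<n. g i l) = \<alpha>" if i: "i < n" for i
  proof -
    have "(M *\<^sub>v ones_vec n) $ i = (\<Sum>l<n. g i l)"
      using M i by (simp add: scalar_prod_def lessThan_atLeast0 M_g ones_vec_def)
    then show ?thesis unfolding M_ones using i by (simp add: ones_vec_def)
  qed
  have g_sum': "(\<Sum>l<n. g l i) = \<alpha>" if i: "i < n" for i
    using g_sum[OF i] g_sym[OF i] by simp

  have A: "A \<in> carrier_mat n n" by (simp add: A_def adjacency_mat_def)
  \<comment> \<open>The map \<open>x\<close> to \<open>s x + 1/2\<close> sends \<beta> to
    \<open>1\<close> and \<open>-\<beta>\<close> to \<open>0\<close>; on the diagonal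
    \<open>t\<close> equals \<open>s + 1/2\<close>, which makes the entry \<open>0\<close>.\<close>
  have A_entry: "A $$ (i, j) = s * g i j - t * (if i = j then 1 else 0) + 1 / 2"
    if ij: "i < n" "j < n" for i j
  proof (cases "i = j")
    case True
    then show ?thesis
      using ij \<beta> unit[OF ij(1)]
      by (simp add: A_def adjacency_mat_def G_def g_def s_def t_def field_simps)
  next
    case False
    then show ?thesis
      using ij \<beta> angle[OF ij]
      by (auto simp: A_def adjacency_mat_def G_def g_def s_def t_def field_simps)
  qed
  have A_sum: "(\<Sum>l<n. A $$ (i, l)) = s * \<alpha> - t + real n / 2" if i: "i < n" for i
    using i g_sum[OF i]
    by (simp add: A_entry sum.distrib sum_subtractf flip: sum_distrib_left)
  have A_square: "(\<Sum>l<n. A $$ (i, l) * A $$ (l, j)) =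
      (s * \<alpha> - 2 * t) * A $$ (i, j) + t * (s * \<alpha> - t) * (if i = j then 1 else 0)
      + (real n / 4 + s * \<alpha> / 2)" if ij: "i < n" "j < n" for i j
  proof -
    define d :: "nat \<Rightarrow> nat \<Rightarrow> real" where "d = (\<lambda>i j. if i = j then 1 else 0)"
    have d_left: "(\<Sum>l<n. d i l * f l) = f i" and d_right: "(\<Sum>l<n. f l * d l j) = f j" for f
      using ij by (simp_all add: d_def if_distrib if_distribR sum.delta cong: if_cong)
    have d_left1: "(\<Sum>l<n. d i l) = 1" and d_right1: "(\<Sum>l<n. d l j) = 1"
      using ij by (simp_all add: d_def)
    \<comment> \<open>The product of two three-term entries gives nine terms, each of which has a
      known sum over \<open>l\<close>.\<close>
    have "(\<Sum>l<n. A $$ (i, l) * A $$ (l, j)) =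
        (\<Sum>l<n. s\<^sup>2 * (g i l * g l j) - s * t * (g i l * d l j) - s * t * (d i l * g l j)
          + s / 2 * g i l + s / 2 * g l j - t / 2 * d i l - t / 2 * d l j
          + t\<^sup>2 * (d i l * d l j) + 1 / 4)"
      using ij by (intro sum.cong refl)
        (simp only: A_entry lessThan_iff, simp add: d_def[symmetric, THEN fun_cong, THEN fun_cong] algebra_simps power2_eq_square)
    also have "\<dots> = s\<^sup>2 * (\<alpha> * g i j) - s * t * g i j - s * t * g i j
          + s / 2 * \<alpha> + s / 2 * \<alpha> - t / 2 - t / 2 + t\<^sup>2 * d i j + real n / 4"
      by (simp only: sum.distrib sum_subtractf sum_distrib_left[symmetric] g_square[OF ij]
          g_sum[OF ij(1)] g_sum'[OF ij(2)] d_left d_right d_left1 d_right1) simp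
    also have "\<dots> = (s * \<alpha> - 2 * t) * (s * g i j - t * d i j + 1 / 2) + t * (s * \<alpha> - t) * d i j
      + (real n / 4 + s * \<alpha> / 2)"
      by (simp add: algebra_simps power2_eq_square)
    finally show ?thesis using ij by (simp only: A_entry d_def)
  qed

  show thesis
  proof (rule that[of G])
    show "pair_graph G"
      by unfold_locales
        (auto simp: G_def symmetric_def sym_def g_sym intro: finite_subset[of _ "{0..<n} \<times> {0..<n}"])
    show "pverts G = {0..<n}" by (simp add: G_def)
    show "adjacency_mat n G = s \<cdot>\<^sub>m (transpose_mat \<Phi> * \<Phi>) - t \<cdot>\<^sub>m 1\<^sub>m n + (1 / 2) \<cdot>\<^sub>m ones_mat n"
      using A M unfolding A_def[symmetric] M_def[symmetric]
      by (intro eq_matI) (auto simp: A_entry M_g ones_mat_def)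
    show "real (out_degree (with_proj G) x) = s * \<alpha> - t + real n / 2" if "x \<in> pverts G" for x
    proof -
      have x: "x < n" using that by (simp add: G_def)
      have "out_arcs (with_proj G) x = Pair x ` {j. j < n \<and> (x, j) \<in> parcs G}"
        by (auto simp: out_arcs_def G_def)
      then have "out_degree (with_proj G) x = card {j. j < n \<and> (x, j) \<in> parcs G}"
        by (simp add: out_degree_def card_image inj_on_def)
      also have "real \<dots> = (\<Sum>j | j < n \<and> (x, j) \<in> parcs G. 1)" by simp
      also have "\<dots> = (\<Sum>j<n. A $$ (x, j))"
        by (rule sum.mono_neutral_cong_left) (use x in \<open>auto simp: A_def adjacency_mat_def\<close>)
      finally show ?thesis using A_sum[OF x] by simp
    qed
    show "adjacency_mat n G * adjacency_mat n G =
      (s * \<alpha> - 2 * t) \<cdot>\<^sub>m adjacency_mat n G + (t * (s * \<alpha> - t)) \<cdot>\<^sub>m 1\<^sub>m n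
      + (real n / 4 + s * \<alpha> / 2) \<cdot>\<^sub>m ones_mat n"
      unfolding A_def[symmetric]
    proof (rule eq_matI, goal_cases)
      case (1 i j)
      then have ij: "i < n" "j < n" by (auto simp: ones_mat_def)
      have "(A * A) $$ (i, j) = (\<Sum>l<n. A $$ (i, l) * A $$ (l, j))"
        using A ij by (simp add: scalar_prod_def lessThan_atLeast0)
      then show ?case using A ij A_square[OF ij] by (simp add: ones_mat_def)
    qed (use A in \<open>auto simp: ones_mat_def\<close>)
  qed
qed

section \<open>Instantiating the Steiner frame and computing the graph parameters\<close>

theorem corollary4p3:
  fixes v k :: nat and r b :: real
  assumes "2 \<le> k" and "k < v"
    and "r = (real v - 1) / (real k - 1)"
    and "b = real v * (real v - 1) / (real k * (real k - 1))"
    and "\<exists>(V :: 'a set) B. bibd_one v k V B \<and> (\<exists>P. parallel_class V B P)"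
    and "\<exists>N H. real N = r + 1 \<and> real_hadamard N H"
  shows "\<exists>n m k_srg l u :: nat.
    real n = real v * (r + 1) \<and>
    real m = b \<and>
    real k_srg = (real v + real k - 1) * (r + 1) / 2 \<and>
    real l = (real v + 3 * real k - 4) * (r + 1) / 4 \<and>
    real u = (real v + real k) * (r + 1) / 4 \<and>
    (\<exists>\<Phi> G. axial_etf m n \<Phi> \<and>
       strongly_regular_graph n k_srg l u G \<and>
       (let \<beta> = sqrt ((real n - b) / (b * (real n - 1))) in
         adjacency_mat n G =
           (1 / (2 * \<beta>)) \<cdot>\<^sub>m (transpose_mat \<Phi> * \<Phi>)
           - ((\<beta> + 1) / (2 * \<beta>)) \<cdot>\<^sub>m 1\<^sub>m n
           + (1 / 2) \<cdot>\<^sub>m ones_mat n))"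
proof -
  obtain V :: "'a set" and B P where D: "bibd_one v k V B" and P: "parallel_class V B P"
    using assms(5) by blast
  obtain N H where N: "real N = r + 1" and H: "real_hadamard N H"
    using assms(6) by blast
  have V: "finite V" "card V = v" using D by (auto simp: bibd_one_def)
  define R where "R = N - 1"
  have r_mult: "r * (real k - 1) = real v - 1" using assms(1,3) by simp
  \<comment> \<open>Because \<open>k < v\<close>, the Hadamard matrix has at least three rows, as
    the divisibility by \<open>4\<close> requires. Its order also shows that the real number
    \<open>r\<close> is the natural number \<open>R\<close>.\<close>
  have r_gt: "r > 1" using assms(1-3) by simp
  then have "real N > 2" using N by simp
  then have N3: "3 \<le> N" by linarith
  then have NR: "N = Suc R" and N_pos: "0 < N" and R_pos: "0 < R" by (auto simp: R_def)
  have R_real: "real R = r" using N NR by simp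
  obtain q where q: "N = 4 * q" using hadamard_order_dvd[OF H N3] by blast

  have "R * (k - 1) = v - 1"
  proof -
    have "real (R * (k - 1)) = real (v - 1)"
      using r_mult assms(1,2) by (simp add: R_real)
    then show ?thesis by (simp only: of_nat_eq_iff)
  qed
  then have rep: "card {b \<in> B. x \<in> b} = R" if "x \<in> V" for x
  proof -
    have "card {b \<in> B. x \<in> b} * (k - 1) = R * (k - 1)"
      using bibd_replication[OF D that] by (simp only: \<open>R * (k - 1) = v - 1\<close>)
    then show ?thesis using assms(1) by simp
  qed
  have b_eq: "b = real v * r / real k"
    unfolding assms(4) r_mult[symmetric] using assms(1) by simp
  have m: "real (card B) = b"
  proof -
    have "real (card B * k) = real (v * R)" using bibd_block_count[OF D rep] by simp
    then have "real (card B) = real v * r / real k" using assms(1) by (simp add: R_real field_simps)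
    then show ?thesis using b_eq by simp
  qed

  obtain h :: "nat \<Rightarrow> nat \<Rightarrow> real" where h:
    "\<And>j. j < N \<Longrightarrow> h 0 j = 1"
    "\<And>i j. i < N \<Longrightarrow> j < N \<Longrightarrow> h i j \<in> {1, -1}"
    "\<And>i j. i < N \<Longrightarrow> j < N \<Longrightarrow> (\<Sum>c<N. h i c * h j c) = (if i = j then real N else 0)"
    "\<And>i j. i < N \<Longrightarrow> j < N \<Longrightarrow> (\<Sum>c<N. h c i * h c j) = (if i = j then real N else 0)"
    by (rule normalized_hadamard[OF H N_pos]) (rule that)
  \<comment> \<open>Disjointness of the parallel class leaves only one of its blocks at
    \<open>x\<close>, so sending that block to \<open>0\<close> settles the second
    condition.\<close>
  have "\<exists>f. bij_betw f {b \<in> B. x \<in> b} {..<R} \<and> (\<forall>b\<in>P. x \<in> b \<longrightarrow> f b = 0)" if x: "x \<in> V" for x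
  proof -
    have PB: "P \<subseteq> B" "\<Union>P = V" "disjoint P"
      using P by (auto simp: parallel_class_def partition_on_def)
    then obtain c where c: "c \<in> P" "x \<in> c" using x by auto
    obtain f where "bij_betw f {b \<in> B. x \<in> b} {..<R}" "f c = 0"
      using ex_bij_betw_lessThan_fixing[of "{b \<in> B. x \<in> b}" R c] rep[OF x] bibd_finite_blocks[OF D] c PB(1)
      by auto
    moreover have "b = c" if "b \<in> P" "x \<in> b" for b
      using PB(3) c that by (auto simp: disjoint_def)
    ultimately show ?thesis by blast
  qed
  then obtain \<rho> where \<rho>: "\<And>x. x \<in> V \<Longrightarrow> bij_betw (\<rho> x) {b \<in> B. x \<in> b} {..<R}"
    "\<And>x b. x \<in> V \<Longrightarrow> b \<in> P \<Longrightarrow> x \<in> b \<Longrightarrow> \<rho> x b = 0" by metis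
  have \<rho>_P: "\<rho> x b = 0" if "b \<in> P" "x \<in> b" for b x
    using P that by (intro \<rho>(2)) (auto simp: parallel_class_def partition_on_def)
  interpret steiner_frame V B P v k R h \<rho>
    by unfold_locales (rule D P R_pos \<rho>(1) \<rho>_P h[unfolded NR]; assumption)+

  let ?n = "v * Suc R" and ?m = "card B" and ?\<alpha> = "real k * real (Suc R) / real R"
    and ?\<beta> = "1 / real R"
  obtain \<Phi> w where \<Phi>: "\<Phi> \<in> carrier_mat ?m ?n"
    and frame: "\<Phi> * transpose_mat \<Phi> = ?\<alpha> \<cdot>\<^sub>m 1\<^sub>m ?m"
    and unit: "\<And>i. i < ?n \<Longrightarrow> col \<Phi> i \<bullet> col \<Phi> i = 1"
    and angle: "\<And>i j. i < ?n \<Longrightarrow> j < ?n \<Longrightarrow> i \<noteq> j \<Longrightarrow> col \<Phi> i \<bullet> col \<Phi> j \<in> {?\<beta>, - ?\<beta>}"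
    and w: "w \<in> carrier_vec ?m" and axial: "transpose_mat \<Phi> *\<^sub>v w = ones_vec ?n"
    by (rule synthesis_matrix) (rule that)
  have \<beta>_pos: "0 < ?\<beta>" using R_pos by simp
  obtain G where G: "pair_graph G" "pverts G = {0..<?n}"
    and adj: "adjacency_mat ?n G = 1 / (2 * ?\<beta>) \<cdot>\<^sub>m (transpose_mat \<Phi> * \<Phi>)
      - (?\<beta> + 1) / (2 * ?\<beta>) \<cdot>\<^sub>m 1\<^sub>m ?n + (1 / 2) \<cdot>\<^sub>m ones_mat ?n"
    and deg: "\<And>x. x \<in> pverts G \<Longrightarrow> real (out_degree (with_proj G) x) =
      1 / (2 * ?\<beta>) * ?\<alpha> - (?\<beta> + 1) / (2 * ?\<beta>) + real ?n / 2"
    and sq: "adjacency_mat ?n G * adjacency_mat ?n G =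
      (1 / (2 * ?\<beta>) * ?\<alpha> - 2 * ((?\<beta> + 1) / (2 * ?\<beta>))) \<cdot>\<^sub>m adjacency_mat ?n G
      + ((?\<beta> + 1) / (2 * ?\<beta>) * (1 / (2 * ?\<beta>) * ?\<alpha> - (?\<beta> + 1) / (2 * ?\<beta>))) \<cdot>\<^sub>m 1\<^sub>m ?n
      + (real ?n / 4 + 1 / (2 * ?\<beta>) * ?\<alpha> / 2) \<cdot>\<^sub>m ones_mat ?n"
    by (rule axial_frame_graph[OF \<Phi> \<beta>_pos frame _ _ w axial])
      (erule unit, erule (2) angle, rule that)

  have s\<alpha>: "1 / (2 * ?\<beta>) * ?\<alpha> = real k * (r + 1) / 2"
    and t: "(?\<beta> + 1) / (2 * ?\<beta>) = (r + 1) / 2" and n: "real ?n = real v * (r + 1)"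
    using r_gt by (simp_all add: R_real[symmetric] field_simps)
  \<comment> \<open>With \<open>r + 1 = 4 q\<close> the fractions \<open>(r + 1) / 2\<close> and
    \<open>(r + 1) / 4\<close> become \<open>2 q\<close> and \<open>q\<close>. The natural
    subtractions do not truncate, since \<open>2 \<le> k < v\<close>.\<close>
  let ?d = "(v + k - 1) * (2 * q)" and ?l = "(v + 3 * k - 4) * q" and ?u = "(v + k) * q"
  have rq: "r + 1 = 4 * real q" using N q by simp
  have d: "real ?d = (real v + real k - 1) * (r + 1) / 2"
    and l: "real ?l = (real v + 3 * real k - 4) * (r + 1) / 4"
    and u: "real ?u = (real v + real k) * (r + 1) / 4"
    using assms(1,2) unfolding rq by simp_all
  have v: "real v = r * (real k - 1) + 1" using r_mult by simp

  have "strongly_regular_graph ?n ?d ?l ?u G"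
    unfolding strongly_regular_graph_def
  proof (intro conjI ballI)
    fix x assume x: "x \<in> pverts G"
    have "real (out_degree (with_proj G) x) = real ?d"
      unfolding deg[OF x] s\<alpha> t n d by (simp add: field_simps)
    then show "out_degree (with_proj G) x = ?d" by (simp only: of_nat_eq_iff)
  next
    have "1 / (2 * ?\<beta>) * ?\<alpha> - 2 * ((?\<beta> + 1) / (2 * ?\<beta>)) = real ?l - real ?u"
      unfolding s\<alpha> t l u by (simp add: field_simps)
    \<comment> \<open>The only coefficient that needs the relation between \<open>v\<close>,
      \<open>k\<close> and \<open>r\<close>, in the form
      \<open>v + k - 2 = (r + 1) (k - 1)\<close>.\<close>
    moreover have "(?\<beta> + 1) / (2 * ?\<beta>) * (1 / (2 * ?\<beta>) * ?\<alpha> - (?\<beta> + 1) / (2 * ?\<beta>)) = real ?d - real ?u"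
      unfolding s\<alpha> t d u v by (simp add: field_simps)
    moreover have "real ?n / 4 + 1 / (2 * ?\<beta>) * ?\<alpha> / 2 = real ?u"
      unfolding s\<alpha> n u by (simp add: field_simps)
    ultimately show "adjacency_mat ?n G * adjacency_mat ?n G =
       (real ?l - real ?u) \<cdot>\<^sub>m adjacency_mat ?n G + (real ?d - real ?u) \<cdot>\<^sub>m 1\<^sub>m ?n + real ?u \<cdot>\<^sub>m ones_mat ?n"
      using sq by (simp only:)
  qed (use G in simp_all)

  moreover have "axial_etf ?m ?n \<Phi>"
    unfolding axial_etf_def equiangular_tight_frame_def
  proof (intro conjI allI impI)
    show "\<Phi> \<in> carrier_mat ?m ?n" by (rule \<Phi>)
    show "sqrt (col \<Phi> i \<bullet> col \<Phi> i) = 1" if "i < ?n" for i using unit[OF that] by simp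
    show "\<exists>c. \<forall>i<?n. \<forall>j<?n. i \<noteq> j \<longrightarrow> \<bar>col \<Phi> i \<bullet> col \<Phi> j\<bar> = c"
      using angle \<beta>_pos by (intro exI[of _ ?\<beta>]) fastforce
    show "\<exists>\<alpha>>0. \<Phi> * transpose_mat \<Phi> = \<alpha> \<cdot>\<^sub>m 1\<^sub>m ?m"
      using frame R_pos assms(1) by (intro exI[of _ ?\<alpha>]) simp
    interpret vec_space "TYPE(real)" ?n .
    show "ones_vec ?n \<in> col_space (transpose_mat \<Phi>)"
    proof -
      have \<Phi>T: "transpose_mat \<Phi> \<in> carrier_mat ?n ?m" using \<Phi> by simp
      have "ones_vec ?n \<in> carrier_vec (dim_row (transpose_mat \<Phi>))"
        using \<Phi>T by (simp add: ones_vec_def)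
      moreover have "w \<in> carrier_vec (dim_col (transpose_mat \<Phi>))" using \<Phi>T w by simp
      ultimately show ?thesis unfolding col_space_eq[OF \<Phi>T] using axial by blast
    qed
  qed

  \<comment> \<open>Numerator and denominator are both multiples of
    \<open>v (v + k - 1) / k\<close>, with factors \<open>1\<close> and the square of
    \<open>r\<close>, so the formula for \<beta> gives the common angle \<open>1 / R\<close> of the
    frame.\<close>
  moreover have "sqrt ((real ?n - b) / (b * (real ?n - 1))) = ?\<beta>"
  proof -
    have vk: "real v + real k - 1 = r * (real k - 1) + real k" using v by simp
    have "real ?n - b = real v * (real v + real k - 1) / real k"
      unfolding n b_eq vk using assms(1) by (simp add: field_simps)
    moreover have "real ?n - 1 = r * (real v + real k - 1)"
      unfolding n using r_mult by (simp add: algebra_simps)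
    then have "b * (real ?n - 1) = r\<^sup>2 * (real v * (real v + real k - 1) / real k)"
      unfolding b_eq by (simp add: power2_eq_square)
    moreover have "real v * (real v + real k - 1) / real k \<noteq> 0"
      using assms(1,2) by simp
    ultimately have "(real ?n - b) / (b * (real ?n - 1)) = ?\<beta>\<^sup>2"
      using r_gt by (simp add: R_real power2_eq_square)
    then show ?thesis using \<beta>_pos by simp
  qed

  ultimately show ?thesis
    using n m d l u adj by (intro exI[of _ ?n] exI[of _ ?m] exI[of _ ?d] exI[of _ ?l] exI[of _ ?u])
      (simp only: Let_def, blast)
qed

end
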